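(* Let $q$ be any prime power and $n$ a positive integer. Let $\mathcal{W}=\{(x_1,\ldots,x_{n+1})\in\mathrm{GF}(q^2)^{n+1} : x_{n+1}=1\}$ and $\mathcal{W}_0=\{(x_1,\ldots,x_{n+1})\in\mathcal{W} : x_n\in C\}$, with $C$, $\mathcal{R}$ and the Hermitian forms $F^g$ ($g\in\mathcal{R}$) as defined in the context. Then the matrix $\mathcal{A}_0=A(F^g, g\in\mathcal{R};\mathcal{W}_0)$, whose rows are indexed by $g\in\mathcal{R}$, whose columns are indexed by $x\in\mathcal{W}_0$, and whose $(g,x)$ entry is $F^g(x)\in\mathrm{GF}(q)$, is a simple orthogonal array $OA(q^{2n-1},q^{2n-2},q,2)$ of index $\mu=q^{2n-3}$.
   Context: Orthogonal arrays: let $\mathcal{Q}$ be a set of $q$ symbols (here $\mathcal{Q}=\mathrm{GF}(q)$). A $k\times N$ matrix with entries in $\mathcal{Q}$ is an orthogonal array $OA(N,k,q,t)$ (with $q$ levels and strength $t$) if every $t\times N$ subarray (obtained by choosing $t$ distinct rows) contains each $t\times 1$ column with entries in $\mathcal{Q}$ exactly $\mu=N/q^t$ times; $\mu$ is called the index of the array. An orthogonal array is simple if it contains no repeated column. Array from functions: given functions $f_1,\ldots,f_k$ on a common finite domain $\mathcal{W}$, $A(f_1,\ldots,f_k;\mathcal{W})$ is the $k\times|\mathcal{W}|$ matrix whose columns are $(f_1(x),\ldots,f_k(x))^T$, $x\in\mathcal{W}$, in an arbitrary order (one column for each $x\in\mathcal{W}$, repetitions kept). Trace: $\mathrm{tr}:\mathrm{GF}(q^2)\to\mathrm{GF}(q)$,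 $\mathrm{tr}(x)=x^q+x$, and $T_0=\{t\in\mathrm{GF}(q^2):\mathrm{tr}(t)=0\}$. Let $C=\{a_1=0,a_2,\ldots,a_q\}$ be a fixed system of representatives for the cosets of the additive subgroup $T_0$ in $\mathrm{GF}(q^2)$. The set $\mathcal{R}$: it is the set of collineations $g$ of $PG(n,q^2)$ given, up to a non-zero scalar, by $(X'_1,\ldots,X'_{n+1})=(X_1,\ldots,X_{n+1})D_g^{-1}$, where $D_g$ is the $(n+1)\times(n+1)$ matrix whose first $n$ rows are the first $n$ rows of the identity matrix and whose last row is $(i_1,i_2,\ldots,i_{n-1},i_n,1)$; here $(i_1,\ldots,i_{n-1})$ ranges over all of $\mathrm{GF}(q^2)^{n-1}$ and, for each such tuple, $i_n$ is the unique element of $C$ satisfying $i_1^{q+1}+\cdots+i_{n-1}^{q+1}+i_n^q+i_n=0$. Thus $|\mathcal{R}|=q^{2n-2}$. Forms: $F(X_1,\ldots,X_{n+1})=X_1^{q+1}+\cdots+X_{n-1}^{q+1}+X_n^qX_{n+1}+X_nX_{n+1}^q$, and for $g\in\mathcal{R}$ with parameters $(i_1,\ldots,i_n)$, $F^g(X)=F(XD_g)$, that is, $$F^g=X_1^{q+1}+\cdots+X_{n-1}^{q+1}+X_n^qX_{n+1}+X_nX_{n+1}^q+X_{n+1}^{q+1}\left(i_1^{q+1}+\cdots+i_{n-1}^{q+1}+i_n^q+i_n\right)+\mathrm{tr}\left(X_{n+1}^q(X_1i_1^q+\cdots+X_{n-1}i_{n-1}^q)\right).$$ All values of $F^g$ on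 $\mathrm{GF}(q^2)^{n+1}$ lie in $\mathrm{GF}(q)$. *)

theory Defs
  imports
    "HOL-Library.FuncSet"
    "HOL-Library.Cardinality"
    "HOL-Number_Theory.Prime_Powers"
    "Jordan_Normal_Form.Gauss_Jordan_Elimination"
begin

section \<open>Orthogonal arrays\<close>

text \<open>
  A \<open>k \<times> N\<close> array is given by a set \<open>Rows\<close> of \<open>k\<close> row indices, a set \<open>Cols\<close> of \<open>N\<close> column
  indices, and an entry function \<open>A\<close>. Columns with different indices may be equal as tuples, so
  repetitions are counted. The index \<open>N / q ^ t\<close> is a rational number: for \<open>t > k\<close> the condition on
  subarrays is vacuous and \<open>N / q ^ t\<close> need not be an integer.
\<close>

definition oa_index :: "nat \<Rightarrow> nat \<Rightarrow> nat \<Rightarrow> rat" where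
  "oa_index N q t = of_nat N / of_nat q ^ t"

definition orthogonal_array ::
  "'s set \<Rightarrow> 'r set \<Rightarrow> 'c set \<Rightarrow> ('r \<Rightarrow> 'c \<Rightarrow> 's) \<Rightarrow> nat \<Rightarrow> nat \<Rightarrow> nat \<Rightarrow> nat \<Rightarrow> bool" where
  "orthogonal_array Q Rows Cols A N k q t \<longleftrightarrow>
     finite Q \<and> card Q = q \<and>
     finite Rows \<and> card Rows = k \<and>
     finite Cols \<and> card Cols = N \<and>
     (\<forall>r\<in>Rows. \<forall>c\<in>Cols. A r c \<in> Q) \<and>
     (\<forall>T. T \<subseteq> Rows \<and> card T = t \<longrightarrow>
        (\<forall>v \<in> T \<rightarrow>\<^sub>E Q. of_nat (card {c \<in> Cols. \<forall>r\<in>T. A r c = v r}) = oa_index N q t))"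

definition simple_array :: "'r set \<Rightarrow> 'c set \<Rightarrow> ('r \<Rightarrow> 'c \<Rightarrow> 's) \<Rightarrow> bool" where
  "simple_array Rows Cols A \<longleftrightarrow>
     (\<forall>c\<in>Cols. \<forall>d\<in>Cols. c \<noteq> d \<longrightarrow> (\<exists>r\<in>Rows. A r c \<noteq> A r d))"

section \<open>The trace\<close>

text \<open>
  Throughout, \<open>GF(q\<^sup>2)\<close> is a type \<open>'a\<close> of class \<open>{finite,field}\<close> with \<open>q ^ 2\<close> elements; its subfield
  \<open>GF(q)\<close> is the fixed field of the Frobenius map \<open>x \<mapsto> x ^ q\<close>.
\<close>

definition GF_sub :: "nat \<Rightarrow> 'a::{finite,field} set" where
  "GF_sub q = {x. x ^ q = x}"

definition tr :: "nat \<Rightarrow> 'a::{finite,field} \<Rightarrow> 'a" where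
  "tr q x = x ^ q + x"

definition T0 :: "nat \<Rightarrow> 'a::{finite,field} set" where
  "T0 q = {t. tr q t = 0}"

definition T0_cosets :: "nat \<Rightarrow> 'a::{finite,field} set set" where
  "T0_cosets q = {(\<lambda>t. x + t) ` T0 q | x. True}"

definition coset_representatives :: "nat \<Rightarrow> 'a::{finite,field} set \<Rightarrow> bool" where
  "coset_representatives q C \<longleftrightarrow> 0 \<in> C \<and> (\<forall>K \<in> T0_cosets q. \<exists>!c. c \<in> C \<inter> K)"

section \<open>Projective space and the set of collineations\<close>

text \<open>
  Vectors are indexed from \<open>0\<close>: the coordinate \<open>X\<^sub>j\<close> is \<open>X $ (j - 1)\<close>, so \<open>X\<^sub>n\<close> is \<open>X $ (n - 1)\<close> and
  \<open>X\<^sub>n\<^sub>+\<^sub>1\<close> is \<open>X $ n\<close>.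
\<close>

definition row_mult :: "'a::semiring_0 vec \<Rightarrow> 'a mat \<Rightarrow> 'a vec" where
  "row_mult X M = transpose_mat M *\<^sub>v X"

text \<open>The points of \<open>PG(n, q\<^sup>2)\<close> are the one-dimensional subspaces of \<open>GF(q\<^sup>2) ^ (n + 1)\<close>.\<close>

definition PG_points :: "nat \<Rightarrow> 'a::{finite,field} vec set set" where
  "PG_points n = {range (\<lambda>c. c \<cdot>\<^sub>v X) | X. X \<in> carrier_vec (n + 1) \<and> X \<noteq> 0\<^sub>v (n + 1)}"

text \<open>
  The collineation given, up to a non-zero scalar, by \<open>X' = X M\<close>; outside of the set of points
  it is \<open>undefined\<close>.
\<close>

definition collineation_of :: "nat \<Rightarrow> 'a::{finite,field} mat \<Rightarrow> ('a vec set \<Rightarrow> 'a vec set)" where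
  "collineation_of n M = (\<lambda>P \<in> PG_points n. (\<lambda>X. row_mult X M) ` P)"

text \<open>The parameter \<open>i\<^sub>n\<close> determined by \<open>a = (i\<^sub>1, \<dots>, i\<^sub>n\<^sub>-\<^sub>1)\<close>.\<close>

definition last_param :: "nat \<Rightarrow> nat \<Rightarrow> 'a::{finite,field} set \<Rightarrow> 'a vec \<Rightarrow> 'a" where
  "last_param q n C a =
     (THE c. c \<in> C \<and> (\<Sum>j<n - 1. (a $ j) ^ (q + 1)) + c ^ q + c = 0)"

definition D_mat :: "nat \<Rightarrow> nat \<Rightarrow> 'a::{finite,field} set \<Rightarrow> 'a vec \<Rightarrow> 'a mat" where
  "D_mat q n C a = mat (n + 1) (n + 1) (\<lambda>(r, c).
     if r < n then (if r = c then 1 else 0)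
     else if c < n - 1 then a $ c
     else if c = n - 1 then last_param q n C a
     else 1)"

definition D_mats :: "nat \<Rightarrow> nat \<Rightarrow> 'a::{finite,field} set \<Rightarrow> 'a mat set" where
  "D_mats q n C = {D_mat q n C a | a. a \<in> carrier_vec (n - 1)}"

text \<open>The matrices in \<open>D_mats\<close> are invertible, so \<open>mat_inverse\<close> always returns \<open>Some\<close> below.\<close>

definition R_set :: "nat \<Rightarrow> nat \<Rightarrow> 'a::{finite,field} set \<Rightarrow> ('a vec set \<Rightarrow> 'a vec set) set" where
  "R_set q n C = {collineation_of n (the (mat_inverse D)) | D. D \<in> D_mats q n C}"

definition D_of :: "nat \<Rightarrow> nat \<Rightarrow> 'a::{finite,field} set \<Rightarrow> ('a vec set \<Rightarrow> 'a vec set) \<Rightarrow> 'a mat" where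
  "D_of q n C g = (THE D. D \<in> D_mats q n C \<and> g = collineation_of n (the (mat_inverse D)))"

section \<open>The Hermitian forms and their domain\<close>

definition F_form :: "nat \<Rightarrow> nat \<Rightarrow> 'a::{finite,field} vec \<Rightarrow> 'a" where
  "F_form q n X =
     (\<Sum>j<n - 1. (X $ j) ^ (q + 1)) + (X $ (n - 1)) ^ q * X $ n + X $ (n - 1) * (X $ n) ^ q"

definition F_conj ::
  "nat \<Rightarrow> nat \<Rightarrow> 'a::{finite,field} set \<Rightarrow> ('a vec set \<Rightarrow> 'a vec set) \<Rightarrow> 'a vec \<Rightarrow> 'a" where
  "F_conj q n C g X = F_form q n (row_mult X (D_of q n C g))"

definition W_set :: "nat \<Rightarrow> 'a::{finite,field} vec set" where
  "W_set n = {x \<in> carrier_vec (n + 1). x $ n = 1}"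

definition W0_set :: "nat \<Rightarrow> 'a::{finite,field} set \<Rightarrow> 'a vec set" where
  "W0_set n C = {x \<in> W_set n. x $ (n - 1) \<in> C}"

end

theory Submission
  imports
    Defs
    "HOL-Number_Theory.Residues"
    "Berlekamp_Zassenhaus.Berlekamp_Type_Based"
begin

text \<open>
  On a column \<open>x = (u, c, 1)\<close> the form of parameter \<open>a = (i\<^sub>1, \<dots>, i\<^sub>n\<^sub>-\<^sub>1)\<close> takes the value
  \<open>N(u) + tr(\<langle>u, a\<rangle>) + tr(c)\<close>, where \<open>N\<close> is the sum of the norms and \<open>\<langle>u, a\<rangle>\<close> is the standard
  sesquilinear product. Two rows \<open>a \<noteq> b\<close> with prescribed values \<open>v, w\<close> thus constrain \<open>u\<close> by
  \<open>tr(\<langle>u, a - b\<rangle>) = v - w\<close> only, one fibre of a surjective additive map onto \<open>GF(q)\<close>, and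
  then \<open>c\<close> is determined, since the trace maps \<open>C\<close> bijectively onto \<open>GF(q)\<close>. If all rows agree
  on two columns, then non-degeneracy of \<open>tr(\<langle>u, a\<rangle>)\<close> forces the columns to be equal.
\<close>

section \<open>Auxiliary facts on fibres, finite fields and row vectors\<close>

lemma card_eq_sum_fibres:
  assumes "finite V" "finite S" "f ` V \<subseteq> S"
  shows "card V = (\<Sum>w\<in>S. card {x \<in> V. f x = w})"
proof -
  have "V = (\<Union>w\<in>S. {x \<in> V. f x = w})" using assms(3) by auto
  then have "card V = card (\<Union>w\<in>S. {x \<in> V. f x = w})" by simp
  also have "\<dots> = (\<Sum>w\<in>S. card {x \<in> V. f x = w})"
    using assms(1,2) by (intro card_UN_disjoint) auto
  finally show ?thesis .
qed

text \<open>
  The library has this for the class \<open>finite_field\<close> only, which does not contain the sort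
  \<open>{finite,field}\<close>.
\<close>

lemma power_card_eq_same: "(x :: 'a::{finite,field}) ^ CARD('a) = x"
proof (cases "x = 0")
  case False
  have "(\<Prod>y\<in>UNIV-{0}. y) = (\<Prod>y\<in>UNIV-{0}. x * y)"
    by (rule prod.reindex_bij_witness[of _ "\<lambda>y. x * y" "\<lambda>y. y / x"]) (use False in auto)
  also have "\<dots> = x ^ (CARD('a) - 1) * (\<Prod>y\<in>UNIV-{0}. y)"
    by (simp add: prod.distrib)
  finally have "x ^ (CARD('a) - 1) = 1" by simp
  then show ?thesis using power_minus_mult[of "CARD('a)" x] by simp
qed simp

lemma row_mult_mult:
  fixes A B :: "'b::comm_semiring_0 mat"
  assumes "A \<in> carrier_mat k k" "B \<in> carrier_mat k k" "X \<in> carrier_vec k"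
  shows "row_mult (row_mult X A) B = row_mult X (A * B)"
  unfolding row_mult_def transpose_mult[OF assms(1,2)]
  using assms by (intro assoc_mult_mat_vec[symmetric]) auto

locale hermitian_array =
  fixes q n :: nat and C :: "'a::{finite,field} set"
  assumes primepow_q: "primepow q" and card_field: "CARD('a) = q ^ 2"
    and n_ge_1: "n \<ge> 1" and coset_reps: "coset_representatives q C"
begin

section \<open>The Frobenius map, the trace and the subfield of order \<open>q\<close>\<close>

lemma q_gt_1: "q > 1"
  using primepow_gt_Suc_0[OF primepow_q] by simp

text \<open>The characteristic is a prime dividing the field order \<open>q ^ 2\<close>, so it is
  the prime of which \<open>q\<close> is a power. This makes the freshman's dream applicable to
  exponent \<open>q\<close>.\<close>

lemma q_eq_CHAR_power: "\<exists>k. q = CHAR('a) ^ k"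
proof -
  obtain p k where p: "prime p" "q = p ^ k"
    using primepow_q unfolding primepow_def by auto
  have pr: "prime CHAR('a)"
    by (simp add: finite_imp_CHAR_pos prime_CHAR_semidom)
  have "CHAR('a) dvd q ^ 2"
    using CHAR_dvd_CARD[where 'a = 'a] card_field by simp
  then have "CHAR('a) dvd p"
    using pr p(2) prime_dvd_power by blast
  then have "CHAR('a) = p"
    using pr p(1) primes_dvd_imp_eq by blast
  with p show ?thesis by blast
qed

lemma frobenius_add: "(x + y :: 'a) ^ q = x ^ q + y ^ q"
proof -
  obtain k where "q = CHAR('a) ^ k" using q_eq_CHAR_power by blast
  moreover have "prime CHAR('a)"
    by (simp add: finite_imp_CHAR_pos prime_CHAR_semidom)
  ultimately show ?thesis using freshmans_dream' by blast
qed

text \<open>Follows from additivity alone, so even and odd \<open>q\<close> need no separate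
  treatment.\<close>

lemma frobenius_minus: "(- x :: 'a) ^ q = - (x ^ q)"
  using frobenius_add[of x "- x"] q_gt_1
  by (intro minus_unique[symmetric]) (simp add: zero_power)

lemma frobenius_sum: "(sum f A :: 'a) ^ q = (\<Sum>i\<in>A. f i ^ q)"
  by (induction A rule: infinite_finite_induct) (use q_gt_1 in \<open>auto simp: frobenius_add\<close>)

lemma frobenius_frobenius: "((x :: 'a) ^ q) ^ q = x"
  using power_card_eq_same[of x] card_field
  by (simp add: power_mult[symmetric] power2_eq_square)

lemma frobenius_diff: "(x - y :: 'a) ^ q = x ^ q - y ^ q"
  using frobenius_add[of x "- y"] by (simp add: frobenius_minus)

lemma tr_add: "tr q (x + y :: 'a) = tr q x + tr q y"
  by (simp add: tr_def frobenius_add)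

lemma tr_diff: "tr q (x - y :: 'a) = tr q x - tr q y"
  by (simp add: tr_def frobenius_diff)

lemma tr_0: "tr q (0 :: 'a) = 0"
  using q_gt_1 by (simp add: tr_def)

lemma tr_in_GF_sub: "tr q (x :: 'a) \<in> GF_sub q"
  by (simp add: tr_def GF_sub_def frobenius_add frobenius_frobenius add.commute)

lemma GF_sub_add: "x \<in> GF_sub q \<Longrightarrow> y \<in> GF_sub q \<Longrightarrow> (x + y :: 'a) \<in> GF_sub q"
  by (simp add: GF_sub_def frobenius_add)

lemma GF_sub_diff: "x \<in> GF_sub q \<Longrightarrow> y \<in> GF_sub q \<Longrightarrow> (x - y :: 'a) \<in> GF_sub q"
  by (simp add: GF_sub_def frobenius_diff)

lemma norm_in_GF_sub: "(x :: 'a) ^ (q + 1) \<in> GF_sub q"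
  by (simp add: GF_sub_def power_mult_distrib frobenius_frobenius mult.commute)

text \<open>A polynomial of degree \<open>q\<close> has at most \<open>q\<close> roots. The choice
  \<open>c = - 1\<close> bounds the subfield, and \<open>c = 1\<close> bounds the kernel of the
  trace.\<close>

lemma card_roots_perturbed_power: "card {x :: 'a. x ^ q + c * x = 0} \<le> q"
proof -
  let ?p = "monom 1 q + monom c 1 :: 'a poly"
  \<comment> \<open>Since \<open>q > 1\<close>, the linear term does not meet the leading
    one.\<close>
  have "coeff ?p q = 1" using q_gt_1 by simp
  then have "?p \<noteq> 0" by (metis coeff_0 zero_neq_one)
  have "degree ?p \<le> q"
    using q_gt_1 by (intro degree_add_le) (auto intro: order.trans[OF degree_monom_le])
  have "card {x. poly ?p x = 0} \<le> degree ?p"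
    using \<open>?p \<noteq> 0\<close> by (rule card_poly_roots_bound)
  then show ?thesis using \<open>degree ?p \<le> q\<close> by (simp add: poly_monom)
qed

lemma card_GF_sub_le: "card (GF_sub q :: 'a set) \<le> q"
  using card_roots_perturbed_power[of "- 1"] by (simp add: GF_sub_def)

text \<open>A non-empty fibre is a translate of the kernel.\<close>

lemma card_tr_fibre_le: "card {x :: 'a. tr q x = w} \<le> q"
proof (cases "\<exists>y. tr q y = w")
  case True
  then obtain y where y: "tr q y = w" by blast
  have "(\<lambda>x. x - y) ` {x. tr q x = w} \<subseteq> {x. x ^ q + 1 * x = 0}"
    using y by (auto simp: tr_diff simp flip: tr_def)
  then have "card {x. tr q x = w} \<le> card {x :: 'a. x ^ q + 1 * x = 0}"
    by (intro card_inj_on_le[of "\<lambda>x. x - y"]) (auto simp: inj_on_def)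
  then show ?thesis using card_roots_perturbed_power[of 1] by simp
qed auto

text \<open>
  The \<open>q\<^sup>2\<close> elements are spread by the trace over at most \<open>q\<close> values with fibres of size at
  most \<open>q\<close>, so all these bounds are attained.
\<close>

lemma range_tr: "range (tr q) = (GF_sub q :: 'a set)"
  and card_GF_sub: "card (GF_sub q :: 'a set) = q"
proof -
  have "q ^ 2 = (\<Sum>w\<in>range (tr q). card {x :: 'a. tr q x = w})"
    using card_eq_sum_fibres[of "UNIV :: 'a set" "range (tr q)" "tr q"] card_field by simp
  also have "\<dots> \<le> card (range (tr q) :: 'a set) * q"
    using sum_bounded_above[of "range (tr q)" "\<lambda>w. card {x :: 'a. tr q x = w}" q]
      card_tr_fibre_le by simp
  finally have ge: "q \<le> card (range (tr q) :: 'a set)"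
    using q_gt_1 by (simp add: power2_eq_square)
  have sub: "range (tr q) \<subseteq> (GF_sub q :: 'a set)" using tr_in_GF_sub by auto
  then have "card (range (tr q) :: 'a set) \<le> card (GF_sub q :: 'a set)"
    by (intro card_mono) auto
  with ge show "card (GF_sub q :: 'a set) = q" using card_GF_sub_le by simp
  with ge sub show "range (tr q) = (GF_sub q :: 'a set)"
    by (intro card_seteq) auto
qed

text \<open>By surjectivity of the trace, the fibre over \<open>w\<close> is a coset of
  \<open>T0 q\<close>, which \<open>C\<close> meets exactly once.\<close>

lemma tr_coset_rep_ex1:
  assumes "w \<in> GF_sub q"
  shows "\<exists>!c. c \<in> C \<and> tr q c = w"
proof -
  obtain y where y: "tr q y = w" using assms range_tr by (metis imageE)
  have "(\<lambda>t. y + t) ` T0 q = {z. tr q z = w}"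
  proof -
    have "z \<in> (\<lambda>t. y + t) ` T0 q" if "tr q z = w" for z
      using that y by (intro image_eqI[of _ _ "z - y"]) (auto simp: T0_def tr_diff)
    then show ?thesis using y by (auto simp: T0_def tr_add)
  qed
  then have "{z. tr q z = w} \<in> T0_cosets q" unfolding T0_cosets_def by blast
  then have "\<exists>!c. c \<in> C \<inter> {z. tr q z = w}"
    using coset_reps by (simp only: coset_representatives_def Ball_def)
  then show ?thesis by simp
qed

lemma card_C: "card C = q"
proof -
  have "bij_betw (tr q) C (GF_sub q)"
    unfolding bij_betw_def
  proof
    show "inj_on (tr q) C"
      using tr_coset_rep_ex1 tr_in_GF_sub unfolding inj_on_def by metis
    show "tr q ` C = GF_sub q"
    proof
      show "tr q ` C \<subseteq> GF_sub q" using tr_in_GF_sub by auto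
      show "GF_sub q \<subseteq> tr q ` C"
      proof
        fix w :: 'a assume "w \<in> GF_sub q"
        then show "w \<in> tr q ` C" using tr_coset_rep_ex1 by blast
      qed
    qed
  qed
  then show ?thesis using bij_betw_same_card card_GF_sub by metis
qed

section \<open>Norm, sesquilinear product and the last parameter\<close>

definition hnorm :: "'a vec \<Rightarrow> 'a" where
  "hnorm a = (\<Sum>j<n - 1. (a $ j) ^ (q + 1))"

definition hprod :: "'a vec \<Rightarrow> 'a vec \<Rightarrow> 'a" where
  "hprod u a = (\<Sum>j<n - 1. u $ j * (a $ j) ^ q)"

lemma hnorm_in_GF_sub: "hnorm a \<in> GF_sub q"
  using norm_in_GF_sub by (simp add: hnorm_def GF_sub_def frobenius_sum)

text \<open>The description in \<open>last_param\<close> amounts to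
  \<open>tr q c = - hnorm a\<close> with right-hand side in the subfield, so it has exactly one
  solution in \<open>C\<close>.\<close>

lemma last_param_in: "last_param q n C a \<in> C"
  and tr_last_param: "tr q (last_param q n C a) = - hnorm a"
proof -
  have "- hnorm a \<in> GF_sub q"
    using hnorm_in_GF_sub[of a] by (simp add: GF_sub_def frobenius_minus)
  then have "\<exists>!c. c \<in> C \<and> tr q c = - hnorm a" by (rule tr_coset_rep_ex1)
  moreover have "(\<lambda>c. c \<in> C \<and> (\<Sum>j<n - 1. (a $ j) ^ (q + 1)) + c ^ q + c = 0)
      = (\<lambda>c. c \<in> C \<and> tr q c = - hnorm a)"
    by (auto simp: hnorm_def tr_def eq_neg_iff_add_eq_0 algebra_simps)
  ultimately have "last_param q n C a \<in> C \<and> tr q (last_param q n C a) = - hnorm a"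
    unfolding last_param_def using theI' by simp
  then show "last_param q n C a \<in> C" "tr q (last_param q n C a) = - hnorm a" by auto
qed

section \<open>The matrices \<open>D_mat\<close> and their collineations\<close>

lemma D_mat_carrier: "D_mat q n C a \<in> carrier_mat (n + 1) (n + 1)"
  by (simp add: D_mat_def)

lemma row_mult_D_mat:
  assumes "X \<in> carrier_vec (n + 1)" "j < n + 1"
  shows "row_mult X (D_mat q n C a) $ j =
    (if j < n then X $ j + D_mat q n C a $$ (n, j) * X $ n else X $ n)"
proof -
  have "row_mult X (D_mat q n C a) $ j = (\<Sum>i<n + 1. D_mat q n C a $$ (i, j) * X $ i)"
    using assms by (auto simp: row_mult_def D_mat_def scalar_prod_def atLeast0LessThan)
  also have "\<dots> = (\<Sum>i<n. D_mat q n C a $$ (i, j) * X $ i) + D_mat q n C a $$ (n, j) * X $ n"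
    by simp
  also have "(\<Sum>i<n. D_mat q n C a $$ (i, j) * X $ i) = (\<Sum>i<n. if i = j then X $ i else 0)"
    using assms by (intro sum.cong) (auto simp: D_mat_def)
  also have "\<dots> = (if j < n then X $ j else 0)" by simp
  finally show ?thesis using assms n_ge_1 by (auto simp: D_mat_def)
qed

lemma det_D_mat: "det (D_mat q n C a) = 1"
proof -
  have "det (D_mat q n C a) = prod_list (diag_mat (D_mat q n C a))"
    by (rule det_lower_triangular[OF _ D_mat_carrier]) (auto simp: D_mat_def)
  also have "diag_mat (D_mat q n C a) = map (\<lambda>i. 1) [0..<n + 1]"
    using n_ge_1 by (auto simp: diag_mat_def D_mat_def)
  finally show ?thesis by (simp add: map_replicate_const)
qed

text \<open>Determinant \<open>1\<close> makes the matrix a unit of the matrix ring, so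
  \<open>mat_inverse\<close> cannot return \<open>None\<close> and \<open>the\<close> yields the
  true inverse.\<close>

lemma mat_inverse_D_mat:
  defines "B a \<equiv> the (mat_inverse (D_mat q n C a))"
  shows "D_mat q n C a * B a = 1\<^sub>m (n + 1)" "B a * D_mat q n C a = 1\<^sub>m (n + 1)"
    "B a \<in> carrier_mat (n + 1) (n + 1)"
proof -
  have "D_mat q n C a \<in> Units (ring_mat TYPE('a) (n + 1) ())"
    by (rule det_non_zero_imp_unit[OF D_mat_carrier]) (simp add: det_D_mat)
  then have "mat_inverse (D_mat q n C a) = Some (B a)"
    using mat_inverse(1)[OF D_mat_carrier, where b = "()"] unfolding B_def
    by (cases "mat_inverse (D_mat q n C a)") auto
  from mat_inverse(2)[OF D_mat_carrier this]
  show "D_mat q n C a * B a = 1\<^sub>m (n + 1)" "B a * D_mat q n C a = 1\<^sub>m (n + 1)"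
    "B a \<in> carrier_mat (n + 1) (n + 1)" by auto
qed

text \<open>
  The point spanned by the last row of \<open>D\<^sub>a\<close> is mapped to the last base point, and the last
  coordinate \<open>1\<close> fixes the scalar, so the collineation determines \<open>D\<^sub>a\<close>.
\<close>

lemma inj_collineation:
  assumes eq: "collineation_of n (the (mat_inverse (D_mat q n C a))) =
    collineation_of n (the (mat_inverse (D_mat q n C b)))"
    and a: "a \<in> carrier_vec (n - 1)" and b: "b \<in> carrier_vec (n - 1)"
  shows "a = b"
proof -
  let ?D = "D_mat q n C" let ?B = "\<lambda>a. the (mat_inverse (D_mat q n C a))"
  let ?e = "unit_vec (n + 1) n :: 'a vec"
  have e: "?e \<in> carrier_vec (n + 1)" by simp
  define r where "r a = row_mult ?e (?D a)" for a
  have r_carrier: "r a \<in> carrier_vec (n + 1)" for a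
    by (intro carrier_vecI) (simp add: r_def row_mult_def D_mat_def)
  have r_last: "r a $ n = 1" for a
    unfolding r_def by (simp add: row_mult_D_mat)
  have r_a: "r a $ j = a $ j" if "j < n - 1" for a j
    using that unfolding r_def by (subst row_mult_D_mat) (auto simp: D_mat_def)
  have rB: "row_mult (r a) (?B a) = ?e" for a
    unfolding r_def row_mult_mult[OF D_mat_carrier mat_inverse_D_mat(3) e] mat_inverse_D_mat(1)
    by (simp add: row_mult_def)
  have "r a \<noteq> 0\<^sub>v (n + 1)" using r_last[of a] by auto
  define P where "P = range (\<lambda>c. c \<cdot>\<^sub>v r a)"
  have P: "P \<in> PG_points n"
    unfolding P_def PG_points_def using r_carrier \<open>r a \<noteq> 0\<^sub>v (n + 1)\<close> by blast
  have "r a = 1 \<cdot>\<^sub>v r a" by simp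
  then have ra: "r a \<in> P" unfolding P_def by (rule range_eqI)
  have "row_mult (r a) (?B b) \<in> collineation_of n (?B b) P"
    using P ra by (auto simp: collineation_of_def)
  then have "row_mult (r a) (?B b) \<in> collineation_of n (?B a) P"
    using eq by simp
  \<comment> \<open>Collineations act on points, so the images of vectors are compared only up to a
    scalar \<open>c\<close>; multiplying by \<open>?D b\<close> below carries this back to
    \<open>r a\<close> and \<open>r b\<close>.\<close>
  then obtain c where c: "row_mult (r a) (?B b) = row_mult (c \<cdot>\<^sub>v r a) (?B a)"
    using P by (auto simp: collineation_of_def P_def)
  have "row_mult (c \<cdot>\<^sub>v r a) (?B a) = c \<cdot>\<^sub>v ?e"
    using rB[of a] r_carrier[of a] mat_inverse_D_mat(3)[of a]
    unfolding row_mult_def by (subst mult_mat_vec) auto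
  then have "row_mult (r a) (?B b) = c \<cdot>\<^sub>v ?e" using c by simp
  moreover have "row_mult (c \<cdot>\<^sub>v ?e) (?D b) = c \<cdot>\<^sub>v r b"
    unfolding r_def row_mult_def by (intro mult_mat_vec[of _ "n + 1" "n + 1"]) (simp_all add: D_mat_def)
  moreover have "row_mult (row_mult (r a) (?B b)) (?D b) = r a"
    unfolding row_mult_mult[OF mat_inverse_D_mat(3) D_mat_carrier r_carrier] mat_inverse_D_mat(2)
    using r_carrier[of a] by (simp add: row_mult_def)
  ultimately have rc: "r a = c \<cdot>\<^sub>v r b" by simp
  then have "c = 1" using r_last[of a] r_last[of b] r_carrier[of b] by simp
  then have "r a = r b" using rc by simp
  then show ?thesis using r_a a b by (metis carrier_vecD eq_vecI)
qed

definition coll :: "'a vec \<Rightarrow> ('a vec set \<Rightarrow> 'a vec set)" where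
  "coll a = collineation_of n (the (mat_inverse (D_mat q n C a)))"

lemma R_set_eq: "R_set q n C = coll ` carrier_vec (n - 1)"
  unfolding R_set_def D_mats_def coll_def by blast

lemma inj_on_coll: "inj_on coll (carrier_vec (n - 1))"
  unfolding inj_on_def coll_def using inj_collineation by blast

lemma card_R_set: "card (R_set q n C) = q ^ (2 * n - 2)"
  unfolding R_set_eq card_image[OF inj_on_coll] card_carrier_vec card_field
  by (simp add: power_mult[symmetric] diff_mult_distrib2)

text \<open>By injectivity a collineation has a single matrix, so the forms, although indexed by
  collineations, can be computed from \<open>a\<close>.\<close>

lemma D_of_coll:
  assumes "a \<in> carrier_vec (n - 1)"
  shows "D_of q n C (coll a) = D_mat q n C a"
  unfolding D_of_def
proof (rule the_equality)
  show "D_mat q n C a \<in> D_mats q n C \<and>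
      coll a = collineation_of n (the (mat_inverse (D_mat q n C a)))"
    using assms by (auto simp: D_mats_def coll_def)
  fix D assume D: "D \<in> D_mats q n C \<and> coll a = collineation_of n (the (mat_inverse D))"
  then obtain b where "b \<in> carrier_vec (n - 1)" "D = D_mat q n C b"
    unfolding D_mats_def by blast
  with D assms show "D = D_mat q n C a"
    unfolding coll_def using inj_collineation by metis
qed

section \<open>Columns and the values of the forms on them\<close>

definition column :: "'a vec \<times> 'a \<Rightarrow> 'a vec" where
  "column = (\<lambda>(u, c). vec (n + 1) (\<lambda>i. if i < n - 1 then u $ i else if i = n - 1 then c else 1))"

lemma bij_column: "bij_betw column (carrier_vec (n - 1) \<times> C) (W0_set n C)"
proof (rule bij_betw_byWitness[where f' = "\<lambda>x. (vec (n - 1) (\<lambda>i. x $ i), x $ (n - 1))"])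
  show "\<forall>x\<in>W0_set n C. column (vec (n - 1) (\<lambda>i. x $ i), x $ (n - 1)) = x"
  proof
    fix x assume "x \<in> W0_set n C"
    then have x: "x \<in> carrier_vec (n + 1)" "x $ n = 1" by (auto simp: W0_set_def W_set_def)
    have "i = n" if "i < n + 1" "\<not> i < n - 1" "i \<noteq> n - 1" for i using that by simp
    then show "column (vec (n - 1) (\<lambda>i. x $ i), x $ (n - 1)) = x"
      using x by (intro eq_vecI) (auto simp: column_def)
  qed
qed (use n_ge_1 in \<open>auto simp: column_def W0_set_def W_set_def\<close>)

lemma card_W0_set: "card (W0_set n C) = q ^ (2 * n - 1)"
proof -
  have "card (W0_set n C) = (q ^ 2) ^ (n - 1) * q"
    using bij_betw_same_card[OF bij_column]
    by (simp add: card_cartesian_product card_carrier_vec card_field card_C)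
  also have "\<dots> = q ^ Suc (2 * (n - 1))" by (simp add: power_mult)
  also have "Suc (2 * (n - 1)) = 2 * n - 1" using n_ge_1 by simp
  finally show ?thesis .
qed

text \<open>Applying the matrix shifts \<open>u\<close> by \<open>a\<close> and \<open>c\<close> by
  \<open>last_param q n C a\<close>. The trace of the latter is \<open>- hnorm a\<close>, which
  cancels the \<open>hnorm a\<close> from the expanded norms.\<close>

lemma F_conj_column:
  assumes "a \<in> carrier_vec (n - 1)"
  shows "F_conj q n C (coll a) (column (u, c)) = hnorm u + tr q (hprod u a) + tr q c"
proof -
  let ?X = "column (u, c)" let ?Y = "row_mult ?X (D_mat q n C a)"
  have X: "?X \<in> carrier_vec (n + 1)" by (simp add: column_def)
  have Xn: "?X $ n = 1"
  proof -
    \<comment> \<open>Truncated subtraction would give \<open>n - 1 = n\<close> for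
      \<open>n = 0\<close>.\<close>
    have "\<not> n < n - 1" "n \<noteq> n - 1" using n_ge_1 by auto
    then show ?thesis by (simp add: column_def)
  qed
  have Y1: "?Y $ j = u $ j + a $ j" if "j < n - 1" for j
    using that X Xn by (simp add: row_mult_D_mat) (simp add: column_def D_mat_def)
  have Y2: "?Y $ (n - 1) = c + last_param q n C a"
    using n_ge_1 X Xn by (simp add: row_mult_D_mat) (simp add: column_def D_mat_def)
  have Y3: "?Y $ n = 1" using X Xn by (simp add: row_mult_D_mat)
  \<comment> \<open>The two cross terms of each norm are \<open>q\<close>-th powers of each other,
    hence add up to a trace.\<close>
  have "(\<Sum>j<n - 1. (?Y $ j) ^ (q + 1)) =
      (\<Sum>j<n - 1. (u $ j) ^ (q + 1) + (a $ j) ^ (q + 1) + tr q (u $ j * (a $ j) ^ q))"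
    using Y1 by (intro sum.cong)
      (simp_all add: frobenius_add tr_def power_mult_distrib frobenius_frobenius algebra_simps)
  also have "\<dots> = hnorm u + hnorm a + tr q (hprod u a)"
    by (simp add: sum.distrib hnorm_def hprod_def tr_def frobenius_sum)
  finally have "F_form q n ?Y = hnorm u + hnorm a + tr q (hprod u a) + tr q (c + last_param q n C a)"
    unfolding F_form_def Y2 Y3 by (simp add: tr_def)
  then show ?thesis
    unfolding F_conj_def D_of_coll[OF assms] by (simp add: tr_add tr_last_param)
qed

section \<open>Counting solutions of trace equations\<close>

lemma hprod_add_left:
  "u \<in> carrier_vec (n - 1) \<Longrightarrow> v \<in> carrier_vec (n - 1) \<Longrightarrow> hprod (u + v) d = hprod u d + hprod v d"
  by (simp add: hprod_def sum.distrib algebra_simps)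

lemma hprod_diff_left:
  "u \<in> carrier_vec (n - 1) \<Longrightarrow> v \<in> carrier_vec (n - 1) \<Longrightarrow> hprod (u - v) d = hprod u d - hprod v d"
  by (simp add: hprod_def sum_subtractf algebra_simps)

lemma hprod_diff_right:
  "a \<in> carrier_vec (n - 1) \<Longrightarrow> b \<in> carrier_vec (n - 1) \<Longrightarrow> hprod u (a - b) = hprod u a - hprod u b"
  by (simp add: hprod_def frobenius_diff sum_subtractf algebra_simps)

lemma hprod_smult_unit_left:
  assumes "k < n - 1"
  shows "hprod (y \<cdot>\<^sub>v unit_vec (n - 1) k) d = y * (d $ k) ^ q"
proof -
  have "hprod (y \<cdot>\<^sub>v unit_vec (n - 1) k) d = (\<Sum>j<n - 1. if j = k then y * (d $ k) ^ q else 0)"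
    unfolding hprod_def using assms by (intro sum.cong) auto
  then show ?thesis using assms by simp
qed

lemma hprod_smult_unit_right:
  assumes "k < n - 1"
  shows "hprod u (y \<cdot>\<^sub>v unit_vec (n - 1) k) = u $ k * y ^ q"
proof -
  have "hprod u (y \<cdot>\<^sub>v unit_vec (n - 1) k) = (\<Sum>j<n - 1. if j = k then u $ k * y ^ q else 0)"
    unfolding hprod_def using assms q_gt_1 by (intro sum.cong) auto
  then show ?thesis using assms by simp
qed

text \<open>The fibres over the subfield partition the whole space, and translations carry each into
  any other, so all have equal size. The factor \<open>q\<close> on the left avoids a
  division.\<close>

lemma card_tr_hprod_fibre:
  assumes d: "d \<in> carrier_vec (n - 1)" "d \<noteq> 0\<^sub>v (n - 1)" and w: "w \<in> GF_sub q"
  shows "card {u \<in> carrier_vec (n - 1). tr q (hprod u d) = w} * q = q ^ (2 * n - 2)"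
proof -
  let ?fib = "\<lambda>w. {u \<in> carrier_vec (n - 1). tr q (hprod u d) = w}"
  obtain k where k: "k < n - 1" "d $ k \<noteq> 0"
    using d by (metis eq_vecI carrier_vecD index_zero_vec)
  have le: "card (?fib v) \<le> card (?fib w)" if v: "v \<in> GF_sub q" and w: "w \<in> GF_sub q" for v w
  proof -
    have "w - v \<in> range (tr q)" using GF_sub_diff v w range_tr by blast
    then obtain y where y: "tr q y = w - v" by (metis imageE)
    \<comment> \<open>Only a coordinate with \<open>d $ k \<noteq> 0\<close> is used, scaled to make
      \<open>hprod s d = y\<close>.\<close>
    define s where "s = (y / (d $ k) ^ q) \<cdot>\<^sub>v unit_vec (n - 1) k"
    have s: "s \<in> carrier_vec (n - 1)" by (simp add: s_def)
    have "hprod s d = y" unfolding s_def hprod_smult_unit_left[OF k(1)] using k by simp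
    then have "(\<lambda>u. u + s) ` ?fib v \<subseteq> ?fib w"
      using s y by (auto simp: hprod_add_left tr_add)
    moreover have "inj_on (\<lambda>u. u + s) (?fib v)"
    proof (rule inj_onI)
      fix u u' assume u: "u \<in> ?fib v" "u' \<in> ?fib v" "u + s = u' + s"
      have "u $ i = u' $ i" if "i < n - 1" for i
      proof -
        have "(u + s) $ i = (u' + s) $ i" using u(3) by simp
        then show ?thesis using that u(1,2) s by simp
      qed
      then show "u = u'" using u by (intro eq_vecI) auto
    qed
    ultimately show ?thesis by (intro card_inj_on_le) auto
  qed
  have "card (carrier_vec (n - 1) :: 'a vec set) = (\<Sum>v\<in>GF_sub q. card (?fib v))"
    by (rule card_eq_sum_fibres) (auto simp: tr_in_GF_sub)
  also have "\<dots> = (\<Sum>v\<in>(GF_sub q :: 'a set). card (?fib w))"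
    using le w by (intro sum.cong) (auto intro: antisym)
  finally show ?thesis
    by (simp add: card_GF_sub card_carrier_vec card_field power_mult[symmetric]
        diff_mult_distrib2 mult.commute)
qed

lemma card_two_rows:
  assumes a: "a \<in> carrier_vec (n - 1)" and b: "b \<in> carrier_vec (n - 1)" and "a \<noteq> b"
    and v: "v \<in> GF_sub q" "w \<in> GF_sub q"
  shows "card {x \<in> W0_set n C. F_conj q n C (coll a) x = v \<and> F_conj q n C (coll b) x = w} * q
    = q ^ (2 * n - 2)"
proof -
  let ?cols = "{x \<in> W0_set n C. F_conj q n C (coll a) x = v \<and> F_conj q n C (coll b) x = w}"
  let ?pairs = "{p \<in> carrier_vec (n - 1) \<times> C.
    F_conj q n C (coll a) (column p) = v \<and> F_conj q n C (coll b) (column p) = w}"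
  let ?fib = "{u \<in> carrier_vec (n - 1). tr q (hprod u (a - b)) = v - w}"
  have W: "W0_set n C = column ` (carrier_vec (n - 1) \<times> C)"
    and inj: "inj_on column (carrier_vec (n - 1) \<times> C)"
    using bij_column by (auto simp: bij_betw_def)
  have "?cols = column ` ?pairs" unfolding W by auto
  moreover have "inj_on column ?pairs" by (rule inj_on_subset[OF inj]) auto
  ultimately have "card ?cols = card ?pairs" by (simp add: card_image)
  \<comment> \<open>The second equation is replaced by the difference of the two, in which
    \<open>hnorm u\<close> and \<open>c\<close> cancel; the first is solved for
    \<open>tr q c\<close>.\<close>
  also have "?pairs = {(u, c). u \<in> ?fib \<and> c \<in> C \<and> tr q c = v - hnorm u - tr q (hprod u a)}"
    using a b by (auto simp: F_conj_column hprod_diff_right tr_diff algebra_simps)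
  also have "card \<dots> = card ?fib"
  proof (rule bij_betw_same_card[of fst], unfold bij_betw_def, rule)
    have ex1: "\<exists>!c. c \<in> C \<and> tr q c = v - hnorm u - tr q (hprod u a)" for u
      by (intro tr_coset_rep_ex1 GF_sub_diff v hnorm_in_GF_sub tr_in_GF_sub)
    show "inj_on fst {(u, c). u \<in> ?fib \<and> c \<in> C \<and> tr q c = v - hnorm u - tr q (hprod u a)}"
      using ex1 by (fastforce simp: inj_on_def)
    show "fst ` {(u, c). u \<in> ?fib \<and> c \<in> C \<and> tr q c = v - hnorm u - tr q (hprod u a)} = ?fib"
    proof (intro equalityI subsetI)
      fix u assume u: "u \<in> ?fib"
      obtain c where "c \<in> C" "tr q c = v - hnorm u - tr q (hprod u a)" using ex1 by blast
      with u show "u \<in> fst ` {(u, c). u \<in> ?fib \<and> c \<in> C \<and> tr q c = v - hnorm u - tr q (hprod u a)}"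
        by (intro image_eqI[of _ _ "(u, c)"]) auto
    qed auto
  qed
  finally have "card ?cols = card ?fib" .
  moreover have "a - b \<noteq> 0\<^sub>v (n - 1)"
  proof
    assume 0: "a - b = 0\<^sub>v (n - 1)"
    have "a $ i = b $ i" if "i < n - 1" for i
    proof -
      have "(a - b) $ i = 0" using 0 that by simp
      then show ?thesis using that a b by simp
    qed
    then show False using \<open>a \<noteq> b\<close> a b by (metis carrier_vecD eq_vecI)
  qed
  ultimately show ?thesis
    using card_tr_hprod_fibre[of "a - b" "v - w"] a b v GF_sub_diff by simp
qed

section \<open>Index, strength and simplicity of the array\<close>

text \<open>For \<open>n = 1\<close> the exponent is \<open>- 1\<close>, hence the integer power.
  The array then has a single row and the condition on pairs of rows is vacuous.\<close>

lemma oa_index_eq: "oa_index (q ^ (2 * n - 1)) q 2 = of_nat q powi (2 * int n - 3)"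
proof -
  have "int (2 * n - 1) - 2 = 2 * int n - 3" using n_ge_1 by simp
  moreover have "oa_index (q ^ (2 * n - 1)) q 2 = of_nat q powi (int (2 * n - 1) - 2)"
    using q_gt_1 by (subst power_int_diff) (auto simp: oa_index_def)
  ultimately show ?thesis by simp
qed

lemma orthogonal_array_F_conj:
  "orthogonal_array (GF_sub q) (R_set q n C) (W0_set n C) (F_conj q n C)
     (q ^ (2 * n - 1)) (q ^ (2 * n - 2)) q 2"
  unfolding orthogonal_array_def
proof (intro conjI allI impI ballI)
  show "card (GF_sub q :: 'a set) = q" by (rule card_GF_sub)
  show "card (R_set q n C) = q ^ (2 * n - 2)" by (rule card_R_set)
  show "card (W0_set n C) = q ^ (2 * n - 1)" by (rule card_W0_set)
  show "finite (GF_sub q :: 'a set)" by simp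
  show "finite (R_set q n C)" unfolding R_set_eq by simp
  show "finite (W0_set n C)" using bij_betw_finite[OF bij_column] by simp
next
  fix r x assume "r \<in> R_set q n C" "x \<in> W0_set n C"
  moreover have "W0_set n C = column ` (carrier_vec (n - 1) \<times> C)"
    using bij_column by (simp add: bij_betw_def)
  ultimately show "F_conj q n C r x \<in> GF_sub q"
    by (auto simp: R_set_eq F_conj_column intro!: GF_sub_add hnorm_in_GF_sub tr_in_GF_sub)
next
  fix T and v :: "_ \<Rightarrow> 'a"
  assume T: "T \<subseteq> R_set q n C \<and> card T = 2" and v: "v \<in> T \<rightarrow>\<^sub>E GF_sub q"
  from T obtain g h where gh: "T = {g, h}" "g \<noteq> h" by (meson card_2_iff)
  with T obtain a b where ab: "a \<in> carrier_vec (n - 1)" "b \<in> carrier_vec (n - 1)"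
    "g = coll a" "h = coll b" by (auto simp: R_set_eq)
  \<comment> \<open>For \<open>n = 1\<close> the only parameter vector is the empty one, so there
    are no two distinct rows.\<close>
  have n2: "n \<ge> 2"
  proof (rule ccontr)
    assume "\<not> n \<ge> 2"
    then have "n - 1 = 0" by simp
    then have "a = b" using ab by (intro eq_vecI) auto
    with ab gh show False by simp
  qed
  have "card {x \<in> W0_set n C. \<forall>r\<in>T. F_conj q n C r x = v r} * q = q ^ (2 * n - 2)"
    using card_two_rows[OF ab(1,2), of "v g" "v h"] ab gh v by (auto simp: PiE_iff)
  \<comment> \<open>A second factor \<open>q\<close> produces the denominator of
    \<open>oa_index\<close>.\<close>
  then have "card {x \<in> W0_set n C. \<forall>r\<in>T. F_conj q n C r x = v r} * q ^ 2 = q ^ Suc (2 * n - 2)"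
    by (simp add: power2_eq_square)
  also have "Suc (2 * n - 2) = 2 * n - 1" using n2 by simp
  finally have "rat_of_nat (card {x \<in> W0_set n C. \<forall>r\<in>T. F_conj q n C r x = v r} * q ^ 2)
      = rat_of_nat (q ^ (2 * n - 1))"
    by (rule arg_cong)
  then show "of_nat (card {x \<in> W0_set n C. \<forall>r\<in>T. F_conj q n C r x = v r})
      = oa_index (q ^ (2 * n - 1)) q 2"
    using q_gt_1 by (simp add: oa_index_def eq_divide_eq)
qed

lemma simple_array_F_conj: "simple_array (R_set q n C) (W0_set n C) (F_conj q n C)"
  unfolding simple_array_def
proof (intro ballI impI)
  fix x y assume xy: "x \<in> W0_set n C" "y \<in> W0_set n C" "x \<noteq> y"
  have "W0_set n C = column ` (carrier_vec (n - 1) \<times> C)"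
    using bij_column by (simp add: bij_betw_def)
  with xy obtain u c v d where u: "u \<in> carrier_vec (n - 1)" "c \<in> C" "x = column (u, c)"
    and v: "v \<in> carrier_vec (n - 1)" "d \<in> C" "y = column (v, d)" by auto
  show "\<exists>r\<in>R_set q n C. F_conj q n C r x \<noteq> F_conj q n C r y"
  proof (rule ccontr)
    assume "\<not> ?thesis"
    then have eq: "hnorm u + tr q (hprod u a) + tr q c = hnorm v + tr q (hprod v a) + tr q d"
      if "a \<in> carrier_vec (n - 1)" for a
      using that unfolding R_set_eq u(3) v(3) by (simp add: F_conj_column)
    have hprod_0: "hprod z (0\<^sub>v (n - 1)) = 0" for z
      using q_gt_1 by (simp add: hprod_def)
    \<comment> \<open>The row with parameter zero isolates the part that does not depend on
      \<open>a\<close>; subtracting it from the other rows leaves only the product term.\<close>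
    have eq0: "hnorm u + tr q c = hnorm v + tr q d"
      using eq[OF zero_carrier_vec] by (simp only: hprod_0 tr_0 add_0_right)
    have tr_eq: "tr q (hprod (u - v) a) = 0" if "a \<in> carrier_vec (n - 1)" for a
    proof -
      have "(hnorm u + tr q c) + tr q (hprod u a) = (hnorm v + tr q d) + tr q (hprod v a)"
        using eq[OF that] by (simp add: ac_simps)
      then show ?thesis using eq0 u(1) v(1) by (simp add: hprod_diff_left tr_diff)
    qed
    have "u $ k = v $ k" if k: "k < n - 1" for k
    proof (rule ccontr)
      assume "u $ k \<noteq> v $ k"
      then have nz: "(u - v) $ k \<noteq> 0" using k u v by simp
      \<comment> \<open>A coordinate where \<open>u\<close> and \<open>v\<close> differ lets
        \<open>hprod (u - v)\<close> take every value \<open>z\<close>, so the trace would vanish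
        identically. The outer \<open>q\<close>-th power in \<open>y\<close> undoes the one that
        \<open>hprod\<close> applies to its second argument.\<close>
      have tr_zero: "tr q z = 0" for z :: 'a
      proof -
        define y where "y = (z / (u - v) $ k) ^ q"
        have "hprod (u - v) (y \<cdot>\<^sub>v unit_vec (n - 1) k) = z"
          unfolding hprod_smult_unit_right[OF k] y_def frobenius_frobenius using nz by simp
        then show ?thesis using tr_eq[of "y \<cdot>\<^sub>v unit_vec (n - 1) k"] by simp
      qed
      have "range (tr q) = {0 :: 'a}" by (auto simp: tr_zero)
      then show False using range_tr card_GF_sub q_gt_1 by simp
    qed
    then have "u = v" using u v by (metis carrier_vecD eq_vecI)
    with eq0 have "tr q c = tr q d" by simp
    then have "c = d" using tr_coset_rep_ex1[OF tr_in_GF_sub] u(2) v(2) by metis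
    with \<open>u = v\<close> show False using xy u v by simp
  qed
qed

end

theorem theorem3p3:
  fixes q n :: nat and C :: "'a::{finite,field} set"
  assumes "primepow q" and "CARD('a) = q ^ 2" and "n \<ge> 1"
    and "coset_representatives q C"
  shows "orthogonal_array (GF_sub q) (R_set q n C) (W0_set n C) (F_conj q n C)
           (q ^ (2 * n - 1)) (q ^ (2 * n - 2)) q 2 \<and>
         simple_array (R_set q n C) (W0_set n C) (F_conj q n C) \<and>
         oa_index (q ^ (2 * n - 1)) q 2 = of_nat q powi (2 * int n - 3)"
proof -
  interpret hermitian_array q n C
    using assms by unfold_locales
  show ?thesis
    using orthogonal_array_F_conj simple_array_F_conj oa_index_eq by blast
qed

end
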